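(* Let $X_1\subseteq\mathbb{R}^d$ and $X_2\subseteq\mathbb{R}^d$ be finite, and choose $s>s(X_1,X_2)$. Then the map $g\colon\mathrm{Vor}(Z)\to\mathrm{Vor}(X_1,X_2)$ and the map $\mathrm{id}\times\mathrm{pr}\colon\mathbb{R}^d\times\mathbb{R}^{d+1}\to\mathbb{R}^d\times\mathbb{R}^d$ form a morphism $$f=(g,\mathrm{id}\times\mathrm{pr})\colon D\to\mathrm{Del\check{C}}^{X_1,X_2}$$ of dissimilarities, and for every $t>0$ the induced simplicial map $$g\colon ND_t\to N\mathrm{Del\check{C}}^{X_1,X_2}_t$$ is a homotopy equivalence (on geometric realizations).
   Context: Here $d(\cdot,\cdot)$ is Euclidean distance, and $d(p,V)=\inf_{v\in V}d(p,v)$ for a set $V$. **Dissimilarities.** A dissimilarity is a continuous function $\Lambda\colon P\times Q\to[0,\infty]$ with $P,Q$ topological spaces and $[0,\infty]$ carrying the order topology. A morphism $(f_1,f_2)\colon\Lambda\to\Lambda'$ to a dissimilarity $\Lambda'\colon P'\times Q'\to[0,\infty]$ is a pair of continuous maps $f_1\colon P\to P'$, $f_2\colon Q\to Q'$ with $\Lambda'(f_1(x),f_2(y))\le\Lambda(x,y)$ for all $(x,y)$. The Dowker nerve $N\Lambda$ is the filtered simplicial complex in which $N\Lambda_t$ ($t>0$) consists of the finite subsets $\sigma\subseteq P$ for which there is $y\in Q$ with $\Lambda(x,y)<t$ for all $x\in\sigma$. A morphism induces simplicial maps $N\Lambda_t\to N\Lambda'_t$, $\sigma\mapsto f_1(\sigma)$.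 **Voronoi diagrams.** For a finite $W\subseteq\mathbb{R}^m$ and $w\in W$, let $\mathrm{Vor}(W,w)=\{p\in\mathbb{R}^m : d(w,p)\le d(w',p)\text{ for all }w'\in W\}$ and $\mathrm{Vor}(W)=\{(w,\mathrm{Vor}(W,w)) : w\in W\}$. Put $\mathrm{Vor}(X_1,X_2)=\mathrm{Vor}(X_1)\cup\mathrm{Vor}(X_2)$ (union of sets of pairs). These finite sets are discrete. The Delaunay complexes $\mathrm{Del}(W)$ and $\mathrm{Del}(X_1,X_2)$ consist of the subsets $\sigma$ of $\mathrm{Vor}(W)$, respectively $\mathrm{Vor}(X_1,X_2)$, such that the cells $V$ with $(x,V)\in\sigma$ have a common point. For $\sigma$ not in the respective Delaunay complex, let $\varepsilon_\sigma=\inf_p\max_{(x,V)\in\sigma}d(p,V)>0$. **Alpha complex and $s(X_1,X_2)$.** For $\varepsilon>0$ let $h\colon[0,\infty]\to[0,\infty]$ be $h(t)=-\ln(1-t/\varepsilon)$ for $t<\varepsilon$ and $h(t)=\infty$ for $t\ge\varepsilon$. For a finite $W$, with $2\varepsilon<\varepsilon_\sigma$ for all $\sigma\subseteq\mathrm{Vor}(W)$ not in $\mathrm{Del}(W)$, let $\mathrm{Del}^W((w,V),p)=h(d(p,V))$. The alpha complex of $W$ is the Dowker nerve of $((w,V),p)\mapsto\max(d(w,p),\mathrm{Del}^W((w,V),p))$; the filtration value of a simplex is the infimum of the $t$ at which it is present. For $i=1,2$ let $s_i>0$ be larger than every filtration value of the alpha complex of $X_i$, and put $s(X_1,X_2)=\max(s_1,s_2)$.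 **The set $Z$ and the map $g$.** For $s>s(X_1,X_2)$ let $Z=(X_1\times\{s\})\cup(X_2\times\{-s\})\subseteq\mathbb{R}^{d+1}$, let $\mathrm{pr}\colon\mathbb{R}^{d+1}\to\mathbb{R}^d$ omit the last coordinate, and let $g\colon\mathrm{Vor}(Z)\to\mathrm{Vor}(X_1,X_2)$ be given by $((x,s),V)\mapsto(x,\mathrm{Vor}(X_1,x))$ for $x\in X_1$ and $((x,-s),V)\mapsto(x,\mathrm{Vor}(X_2,x))$ for $x\in X_2$. **The dissimilarities.** Choose $\varepsilon>0$ with $2\varepsilon<\varepsilon_\sigma$ for every $\sigma\subseteq\mathrm{Vor}(X_1,X_2)$ not in $\mathrm{Del}(X_1,X_2)$ and for every $\sigma\subseteq\mathrm{Vor}(Z)$ not in $\mathrm{Del}(Z)$, and let $h$ be the corresponding function. Define $$\mathrm{Del}^Z\colon\mathrm{Vor}(Z)\times\mathbb{R}^{d+1}\to[0,\infty],\ ((z,V),q)\mapsto h(d(q,V)),$$ $$\mathrm{Del}^{X_1,X_2}\colon\mathrm{Vor}(X_1,X_2)\times\mathbb{R}^d\to[0,\infty],\ ((x,V),q)\mapsto h(d(q,V)),$$ $$\mathrm{Del\check{C}}^{X_1,X_2}\colon\mathrm{Vor}(X_1,X_2)\times(\mathbb{R}^d\times\mathbb{R}^d)\to[0,\infty],\ ((x,V),(p,q))\mapsto\max(d(x,p),\mathrm{Del}^{X_1,X_2}((x,V),q)),$$ $$D\colon\mathrm{Vor}(Z)\times(\mathbb{R}^d\times\mathbb{R}^{d+1})\to[0,\infty],\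 ((z,V),(p,q))\mapsto\max(d(\mathrm{pr}(z),p),\mathrm{Del}^Z((z,V),q)).$$ *)

theory Defs
  imports "HOL-Analysis.Analysis"
begin

section \<open>Simplicial complexes and their geometric realizations\<close>

text \<open>The empty set is allowed as a simplex. It contributes no point to the realization.\<close>

definition simplicial_complex :: "'v set set \<Rightarrow> bool" where
  "simplicial_complex K \<longleftrightarrow> (\<forall>\<sigma>\<in>K. finite \<sigma> \<and> (\<forall>\<tau>. \<tau> \<subseteq> \<sigma> \<longrightarrow> \<tau> \<in> K))"

definition simplicial_map :: "'v set set \<Rightarrow> 'w set set \<Rightarrow> ('v \<Rightarrow> 'w) \<Rightarrow> bool" where
  "simplicial_map K L f \<longleftrightarrow> (\<forall>\<sigma>\<in>K. f ` \<sigma> \<in> L)"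

text \<open>Points of the realization are given by barycentric coordinates.\<close>

definition closed_simplex :: "'v set \<Rightarrow> ('v \<Rightarrow> real) set" where
  "closed_simplex \<sigma> = {\<alpha>. (\<forall>v. 0 \<le> \<alpha> v) \<and> (\<forall>v. v \<notin> \<sigma> \<longrightarrow> \<alpha> v = 0) \<and> (\<Sum>v\<in>\<sigma>. \<alpha> v) = 1}"

text \<open>The realization carries the weak topology determined by its closed simplices, where
  each closed simplex is topologized as a subspace of the product of copies of the real line.\<close>

definition realization_open :: "'v set set \<Rightarrow> ('v \<Rightarrow> real) set \<Rightarrow> bool" where
  "realization_open K U \<longleftrightarrow> U \<subseteq> (\<Union>\<sigma>\<in>K. closed_simplex \<sigma>) \<and>
     (\<forall>\<sigma>\<in>K. openin (top_of_set (closed_simplex \<sigma>)) (U \<inter> closed_simplex \<sigma>))"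

definition geometric_realization :: "'v set set \<Rightarrow> ('v \<Rightarrow> real) topology" where
  "geometric_realization K = topology (realization_open K)"

lemma istopology_realization_open: "istopology (realization_open K)"
  unfolding istopology_def
proof (intro conjI allI impI)
  fix S T assume S: "realization_open K S" and T: "realization_open K T"
  have "openin (top_of_set (closed_simplex \<sigma>)) (S \<inter> T \<inter> closed_simplex \<sigma>)" if "\<sigma> \<in> K" for \<sigma>
  proof -
    have "S \<inter> T \<inter> closed_simplex \<sigma> = (S \<inter> closed_simplex \<sigma>) \<inter> (T \<inter> closed_simplex \<sigma>)" by blast
    then show ?thesis using S T that by (metis realization_open_def openin_Int)
  qed
  then show "realization_open K (S \<inter> T)" using S by (auto simp: realization_open_def)
next
  fix \<K> assume *: "\<forall>U\<in>\<K>. realization_open K U"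
  have "openin (top_of_set (closed_simplex \<sigma>)) (\<Union>\<K> \<inter> closed_simplex \<sigma>)" if "\<sigma> \<in> K" for \<sigma>
  proof -
    have "\<Union>\<K> \<inter> closed_simplex \<sigma> = (\<Union>U\<in>\<K>. U \<inter> closed_simplex \<sigma>)" by blast
    moreover have "openin (top_of_set (closed_simplex \<sigma>)) (\<Union>U\<in>\<K>. U \<inter> closed_simplex \<sigma>)"
      using * that by (intro openin_Union) (auto simp: realization_open_def)
    ultimately show ?thesis by simp
  qed
  then show "realization_open K (\<Union>\<K>)" using * by (auto simp: realization_open_def)
qed

lemma openin_geometric_realization: "openin (geometric_realization K) U \<longleftrightarrow> realization_open K U"
  by (simp add: geometric_realization_def topology_inverse' istopology_realization_open)

lemma topspace_geometric_realization:
  "topspace (geometric_realization K) = (\<Union>\<sigma>\<in>K. closed_simplex \<sigma>)"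
proof
  show "topspace (geometric_realization K) \<subseteq> (\<Union>\<sigma>\<in>K. closed_simplex \<sigma>)"
    by (auto simp: topspace_def openin_geometric_realization realization_open_def)
  have "(\<Union>\<sigma>\<in>K. closed_simplex \<sigma>) \<inter> closed_simplex \<tau> = closed_simplex \<tau>" if "\<tau> \<in> K" for \<tau>
    using that by blast
  then have "realization_open K (\<Union>\<sigma>\<in>K. closed_simplex \<sigma>)"
    by (simp add: realization_open_def)
  then show "(\<Union>\<sigma>\<in>K. closed_simplex \<sigma>) \<subseteq> topspace (geometric_realization K)"
    by (intro openin_subset) (simp add: openin_geometric_realization)
qed

text \<open>The map of realizations induced by a map of vertices, affine on each simplex.\<close>

definition realization_map :: "('v \<Rightarrow> 'w) \<Rightarrow> ('v \<Rightarrow> real) \<Rightarrow> 'w \<Rightarrow> real" where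
  "realization_map f \<alpha> = (\<lambda>w. \<Sum>v | \<alpha> v \<noteq> 0 \<and> f v = w. \<alpha> v)"

text \<open>The library has only the relation \<open>homotopy_equivalent_space\<close> between spaces.\<close>

definition homotopy_equivalence :: "'a topology \<Rightarrow> 'b topology \<Rightarrow> ('a \<Rightarrow> 'b) \<Rightarrow> bool" where
  "homotopy_equivalence X Y f \<longleftrightarrow> continuous_map X Y f \<and>
     (\<exists>g. continuous_map Y X g \<and>
          homotopic_with (\<lambda>x. True) X X (g \<circ> f) id \<and>
          homotopic_with (\<lambda>x. True) Y Y (f \<circ> g) id)"


section \<open>Dissimilarities and Dowker nerves\<close>

definition dissimilarity :: "'p topology \<Rightarrow> 'q topology \<Rightarrow> ('p \<times> 'q \<Rightarrow> ennreal) \<Rightarrow> bool" where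
  "dissimilarity P Q \<Lambda> \<longleftrightarrow> continuous_map (prod_topology P Q) euclidean \<Lambda>"

definition dissimilarity_morphism ::
  "'p topology \<Rightarrow> 'q topology \<Rightarrow> ('p \<times> 'q \<Rightarrow> ennreal) \<Rightarrow>
   'r topology \<Rightarrow> 's topology \<Rightarrow> ('r \<times> 's \<Rightarrow> ennreal) \<Rightarrow> ('p \<Rightarrow> 'r) \<Rightarrow> ('q \<Rightarrow> 's) \<Rightarrow> bool" where
  "dissimilarity_morphism P Q \<Lambda> P' Q' \<Lambda>' f1 f2 \<longleftrightarrow>
     dissimilarity P Q \<Lambda> \<and> dissimilarity P' Q' \<Lambda>' \<and>
     continuous_map P P' f1 \<and> continuous_map Q Q' f2 \<and>
     (\<forall>x\<in>topspace P. \<forall>y\<in>topspace Q. \<Lambda>' (f1 x, f2 y) \<le> \<Lambda> (x, y))"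

definition dowker_nerve ::
  "'p topology \<Rightarrow> 'q topology \<Rightarrow> ('p \<times> 'q \<Rightarrow> ennreal) \<Rightarrow> real \<Rightarrow> 'p set set" where
  "dowker_nerve P Q \<Lambda> t =
     {\<sigma>. finite \<sigma> \<and> \<sigma> \<subseteq> topspace P \<and> (\<exists>y\<in>topspace Q. \<forall>x\<in>\<sigma>. \<Lambda> (x, y) < ennreal t)}"

lemma simplicial_complex_dowker_nerve: "simplicial_complex (dowker_nerve P Q \<Lambda> t)"
  unfolding simplicial_complex_def dowker_nerve_def using finite_subset by blast

definition filtration_value :: "(real \<Rightarrow> 'v set set) \<Rightarrow> 'v set \<Rightarrow> real" where
  "filtration_value K \<sigma> = Inf {t. 0 < t \<and> \<sigma> \<in> K t}"


section \<open>Voronoi diagrams and Delaunay complexes\<close>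

definition Vor_cell :: "'a::metric_space set \<Rightarrow> 'a \<Rightarrow> 'a set" where
  "Vor_cell W w = {p. \<forall>w'\<in>W. dist w p \<le> dist w' p}"

definition Vor :: "'a::metric_space set \<Rightarrow> ('a \<times> 'a set) set" where
  "Vor W = (\<lambda>w. (w, Vor_cell W w)) ` W"

definition Vor2 :: "'a::metric_space set \<Rightarrow> 'a set \<Rightarrow> ('a \<times> 'a set) set" where
  "Vor2 X1 X2 = Vor X1 \<union> Vor X2"

text \<open>Here \<open>C\<close> is either \<open>Vor W\<close> or \<open>Vor2 X1 X2\<close>.\<close>

definition Delaunay :: "('a \<times> 'a set) set \<Rightarrow> ('a \<times> 'a set) set set" where
  "Delaunay C = {\<sigma>. \<sigma> \<subseteq> C \<and> (\<exists>p. \<forall>c\<in>\<sigma>. p \<in> snd c)}"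

text \<open>For \<open>C\<close> as above, a cell contains its own centre, so the value of \<open>infdist\<close>
  at the empty set plays no role here or below; and a \<open>\<sigma>\<close> outside \<open>Delaunay C\<close> is nonempty and
  finite, so \<open>Max\<close> is the maximum.\<close>

definition Del_eps :: "('a::metric_space \<times> 'a set) set \<Rightarrow> real" where
  "Del_eps \<sigma> = (INF p. Max ((\<lambda>c. infdist p (snd c)) ` \<sigma>))"

definition admissible_eps :: "('a::metric_space \<times> 'a set) set \<Rightarrow> real \<Rightarrow> bool" where
  "admissible_eps C \<epsilon> \<longleftrightarrow> 0 < \<epsilon> \<and> (\<forall>\<sigma>. \<sigma> \<subseteq> C \<and> \<sigma> \<notin> Delaunay C \<longrightarrow> 2 * \<epsilon> < Del_eps \<sigma>)"

definition h_fun :: "real \<Rightarrow> ennreal \<Rightarrow> ennreal" where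
  "h_fun \<epsilon> t = (if t < ennreal \<epsilon> then ennreal (- ln (1 - enn2real t / \<epsilon>)) else \<infinity>)"

text \<open>The Delaunay dissimilarities of \<open>W\<close>, of \<open>Z\<close> and of \<open>X1\<close>, \<open>X2\<close> are all given by this
  formula, on the respective set of cells.\<close>

definition Del_diss :: "real \<Rightarrow> ('a::metric_space \<times> 'a set) \<times> 'a \<Rightarrow> ennreal" where
  "Del_diss \<epsilon> = (\<lambda>(c, q). h_fun \<epsilon> (ennreal (infdist q (snd c))))"

definition alpha_diss :: "real \<Rightarrow> ('a::metric_space \<times> 'a set) \<times> 'a \<Rightarrow> ennreal" where
  "alpha_diss \<epsilon> = (\<lambda>((w, V), p). max (ennreal (dist w p)) (Del_diss \<epsilon> ((w, V), p)))"

definition alpha_complex ::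
  "'a::metric_space set \<Rightarrow> real \<Rightarrow> real \<Rightarrow> ('a \<times> 'a set) set set" where
  "alpha_complex W \<epsilon> = dowker_nerve (discrete_topology (Vor W)) euclidean (alpha_diss \<epsilon>)"


section \<open>The lifted point set and the two dissimilarities\<close>

text \<open>Euclidean space of dimension \<open>d + 1\<close> is modelled as the product of Euclidean space of
  dimension \<open>d\<close> with the real line: the library's metric on products is the Euclidean one,
  and the projection omitting the last coordinate is \<open>fst\<close>.\<close>

definition Z_set :: "'a set \<Rightarrow> 'a set \<Rightarrow> real \<Rightarrow> ('a \<times> real) set" where
  "Z_set X1 X2 s = X1 \<times> {s} \<union> X2 \<times> {- s}"

text \<open>For \<open>s > 0\<close> the last coordinate tells which of the two sets a point of \<open>Z\<close> comes from.\<close>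

definition g_map :: "'a::metric_space set \<Rightarrow> 'a set \<Rightarrow> real \<Rightarrow>
    ('a \<times> real) \<times> ('a \<times> real) set \<Rightarrow> 'a \<times> 'a set" where
  "g_map X1 X2 s = (\<lambda>((x, r), V). (x, Vor_cell (if r = s then X1 else X2) x))"

definition DelCech_diss :: "real \<Rightarrow> ('a::metric_space \<times> 'a set) \<times> ('a \<times> 'a) \<Rightarrow> ennreal" where
  "DelCech_diss \<epsilon> = (\<lambda>((x, V), (p, q)). max (ennreal (dist x p)) (Del_diss \<epsilon> ((x, V), q)))"

definition D_diss :: "real \<Rightarrow>
    (('a::metric_space \<times> real) \<times> ('a \<times> real) set) \<times> ('a \<times> ('a \<times> real)) \<Rightarrow> ennreal" where
  "D_diss \<epsilon> = (\<lambda>((z, V), (p, q)). max (ennreal (dist (fst z) p)) (Del_diss \<epsilon> ((z, V), q)))"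

end

theory Submission
  imports Defs
begin

text \<open>No point lies within \<open>2\<epsilon>\<close> of all the cells of a set outside the Delaunay complex, so both
  nerves consist of the Delaunay simplices whose centres lie in a common ball of radius \<open>t\<close>.
  A point \<open>p\<close> common to the cells of a simplex of \<open>Vor2 X1 X2\<close> lifts to the point
  \<open>(p, (d(p, X1)\<^sup>2 - d(p, X2)\<^sup>2) / (4 s))\<close>, which is equidistant from the two layers of \<open>Z\<close> and
  therefore common to all the cells of \<open>Vor Z\<close> above. So a set of cells of \<open>Vor Z\<close> is a simplex
  if and only if its image under \<open>g\<close> is one. Any section of \<open>g\<close> on vertices is then a simplicial
  homotopy inverse, because its composite with \<open>g\<close> is contiguous to the identity.\<close>

section \<open>Realizations of finite complexes\<close>

lemma closed_closed_simplex: "closed (closed_simplex \<sigma>)"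
proof -
  have "closed_simplex \<sigma> = {\<alpha>. \<forall>v. 0 \<le> \<alpha> v} \<inter> {\<alpha>. \<forall>v. v \<notin> \<sigma> \<longrightarrow> \<alpha> v = 0} \<inter> {\<alpha>. sum \<alpha> \<sigma> = 1}"
    by (auto simp: closed_simplex_def)
  moreover have "closed {\<alpha> :: 'a \<Rightarrow> real. \<forall>v. 0 \<le> \<alpha> v}"
    by (intro closed_Collect_all closed_Collect_le continuous_intros continuous_on_product_coordinates)
  moreover have "closed {\<alpha> :: 'a \<Rightarrow> real. v \<notin> \<sigma> \<longrightarrow> \<alpha> v = 0}" for v
    by (cases "v \<in> \<sigma>")
      (auto intro!: closed_Collect_eq continuous_intros continuous_on_product_coordinates)
  then have "closed {\<alpha> :: 'a \<Rightarrow> real. \<forall>v. v \<notin> \<sigma> \<longrightarrow> \<alpha> v = 0}"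
    by (rule closed_Collect_all)
  moreover have "closed {\<alpha> :: 'a \<Rightarrow> real. sum \<alpha> \<sigma> = 1}"
    by (intro closed_Collect_eq continuous_intros continuous_on_product_coordinates)
  ultimately show ?thesis by (simp add: closed_Int)
qed

text \<open>For a weakly open \<open>U\<close>, each \<open>closed_simplex \<sigma> - U\<close> is
  closed in the full product space, because the simplex itself is closed. Finitely many of these
  sets make up the complement of \<open>U\<close>. Thus the weak topology is the subspace topology,
  and continuity can be tested coordinate by coordinate.\<close>

lemma geometric_realization_finite:
  assumes "finite K"
  shows "geometric_realization K = top_of_set (\<Union>\<sigma>\<in>K. closed_simplex \<sigma>)"
  unfolding topology_eq openin_geometric_realization
proof (intro allI iffI)
  let ?X = "\<Union>\<sigma>\<in>K. closed_simplex \<sigma>"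
  fix U assume U: "realization_open K U"
  have "closedin (top_of_set ?X) (closed_simplex \<sigma> - U)" if "\<sigma> \<in> K" for \<sigma>
  proof -
    have "closedin (top_of_set (closed_simplex \<sigma>)) (closed_simplex \<sigma> - U \<inter> closed_simplex \<sigma>)"
      using U that by (intro closedin_diff) (auto simp: realization_open_def)
    then have "closed (closed_simplex \<sigma> - U)"
      using closedin_closed_trans[OF _ closed_closed_simplex] by (simp add: Diff_Int)
    then show ?thesis using that by (intro closed_subset) auto
  qed
  then have "closedin (top_of_set ?X) (\<Union>\<sigma>\<in>K. closed_simplex \<sigma> - U)"
    using assms by (intro closedin_Union) auto
  moreover have "(\<Union>\<sigma>\<in>K. closed_simplex \<sigma> - U) = ?X - U" by blast
  ultimately show "openin (top_of_set ?X) U"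
    using U by (simp add: openin_closedin_eq realization_open_def)
next
  fix U assume U: "openin (top_of_set (\<Union>\<sigma>\<in>K. closed_simplex \<sigma>)) U"
  then obtain T where T: "open T" "U = (\<Union>\<sigma>\<in>K. closed_simplex \<sigma>) \<inter> T"
    by (auto simp: openin_open)
  then show "realization_open K U"
    unfolding realization_open_def openin_open by blast
qed

text \<open>The index set in the definition varies with the support of \<open>\<alpha>\<close>. A
  fixed finite set containing the support turns each coordinate into a fixed finite sum, fit for
  regrouping and for continuity arguments.\<close>

lemma realization_map_eq_sum:
  assumes "finite V" "\<And>v. v \<notin> V \<Longrightarrow> \<alpha> v = 0"
  shows "realization_map f \<alpha> w = (\<Sum>v | v \<in> V \<and> f v = w. \<alpha> v)"
  unfolding realization_map_def using assms by (intro sum.mono_neutral_left) auto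

lemma realization_map_closed_simplex:
  assumes "finite \<sigma>" "\<alpha> \<in> closed_simplex \<sigma>"
  shows "realization_map f \<alpha> \<in> closed_simplex (f ` \<sigma>)"
proof -
  have *: "realization_map f \<alpha> w = (\<Sum>v | v \<in> \<sigma> \<and> f v = w. \<alpha> v)" for w
    using assms by (intro realization_map_eq_sum) (auto simp: closed_simplex_def)
  have "(\<Sum>w\<in>f ` \<sigma>. realization_map f \<alpha> w) = sum \<alpha> \<sigma>"
    unfolding * using assms(1) by (simp add: sum.image_gen[of \<sigma> \<alpha> f])
  moreover have "realization_map f \<alpha> w = 0" if "w \<notin> f ` \<sigma>" for w
    unfolding * using that by (intro sum.neutral) auto
  ultimately show ?thesis
    using assms(2) by (auto simp: closed_simplex_def * intro!: sum_nonneg)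
qed

lemma realization_map_comp:
  assumes "finite \<sigma>" "\<alpha> \<in> closed_simplex \<sigma>"
  shows "realization_map f (realization_map i \<alpha>) = realization_map (f \<circ> i) \<alpha>"
proof
  fix w
  have supp: "\<And>v. v \<notin> \<sigma> \<Longrightarrow> \<alpha> v = 0" using assms(2) by (auto simp: closed_simplex_def)
  have "realization_map f (realization_map i \<alpha>) w
      = (\<Sum>u | u \<in> i ` \<sigma> \<and> f u = w. \<Sum>v | v \<in> \<sigma> \<and> i v = u. \<alpha> v)"
    using assms realization_map_closed_simplex[OF assms, of i]
    by (subst realization_map_eq_sum[of "i ` \<sigma>"])
      (auto simp: closed_simplex_def realization_map_eq_sum[OF assms(1) supp])
  \<comment> \<open>The extra condition \<open>f (i v) = w\<close> already follows from
    \<open>i v = u\<close> and \<open>f u = w\<close>. It brings the double sum into the shape of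
    \<open>sum.group\<close>, a sum over the fibres of \<open>i\<close>.\<close>
  also have "\<dots> = (\<Sum>u | u \<in> i ` \<sigma> \<and> f u = w. \<Sum>v | v \<in> {v \<in> \<sigma>. f (i v) = w} \<and> i v = u. \<alpha> v)"
    by (intro sum.cong) auto
  also have "\<dots> = (\<Sum>v | v \<in> \<sigma> \<and> f (i v) = w. \<alpha> v)"
    using assms(1) by (intro sum.group) auto
  also have "\<dots> = realization_map (f \<circ> i) \<alpha> w"
    by (simp add: realization_map_eq_sum[OF assms(1) supp])
  finally show "realization_map f (realization_map i \<alpha>) w = realization_map (f \<circ> i) \<alpha> w" .
qed

lemma realization_map_id_on:
  assumes "finite \<sigma>" "\<alpha> \<in> closed_simplex \<sigma>" "\<And>v. v \<in> \<sigma> \<Longrightarrow> f v = v"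
  shows "realization_map f \<alpha> = \<alpha>"
proof
  fix w
  have supp: "\<And>v. v \<notin> \<sigma> \<Longrightarrow> \<alpha> v = 0" using assms(2) by (auto simp: closed_simplex_def)
  have "{v. v \<in> \<sigma> \<and> f v = w} = (if w \<in> \<sigma> then {w} else {})" using assms(3) by auto
  then show "realization_map f \<alpha> w = \<alpha> w"
    using supp by (simp add: realization_map_eq_sum[OF assms(1) supp])
qed

lemma continuous_on_realization_map:
  assumes "finite K" "simplicial_complex K"
  shows "continuous_on (\<Union>\<sigma>\<in>K. closed_simplex \<sigma>) (realization_map f)"
proof (rule continuous_on_coordinatewise_then_product)
  fix w
  have fin: "finite (\<Union>K)" using assms by (auto simp: simplicial_complex_def)
  have "continuous_on (\<Union>\<sigma>\<in>K. closed_simplex \<sigma>) (\<lambda>\<alpha>. \<Sum>v | v \<in> \<Union>K \<and> f v = w. \<alpha> v)"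
    by (intro continuous_on_sum continuous_on_subset[OF continuous_on_product_coordinates]) auto
  then show "continuous_on (\<Union>\<sigma>\<in>K. closed_simplex \<sigma>) (\<lambda>\<alpha>. realization_map f \<alpha> w)"
    by (rule continuous_on_eq)
      (subst realization_map_eq_sum[OF fin]; force simp: closed_simplex_def)
qed

lemma continuous_map_realization_map:
  assumes "finite K" "simplicial_complex K" "finite L" "simplicial_map K L f"
  shows "continuous_map (geometric_realization K) (geometric_realization L) (realization_map f)"
proof -
  have "realization_map f ` (\<Union>\<sigma>\<in>K. closed_simplex \<sigma>) \<subseteq> (\<Union>\<sigma>\<in>L. closed_simplex \<sigma>)"
    using assms(2,4) realization_map_closed_simplex
    by (fastforce simp: simplicial_map_def simplicial_complex_def)
  then show ?thesis
    using continuous_on_realization_map[OF assms(1,2), of f]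
    by (auto simp: geometric_realization_finite assms(1,3))
qed

section \<open>Contiguous maps and full preimages of complexes\<close>

lemma closed_simplex_mono:
  assumes "finite \<tau>" "\<sigma> \<subseteq> \<tau>"
  shows "closed_simplex \<sigma> \<subseteq> closed_simplex \<tau>"
proof
  fix \<alpha> assume \<alpha>: "\<alpha> \<in> closed_simplex \<sigma>"
  then have "sum \<alpha> \<tau> = sum \<alpha> \<sigma>"
    using assms by (intro sum.mono_neutral_right) (auto simp: closed_simplex_def)
  then show "\<alpha> \<in> closed_simplex \<tau>" using \<alpha> assms by (auto simp: closed_simplex_def)
qed

lemma closed_simplex_convex:
  assumes "\<alpha> \<in> closed_simplex \<sigma>" "\<beta> \<in> closed_simplex \<sigma>" "0 \<le> t" "t \<le> 1"
  shows "(\<lambda>v. (1 - t) * \<alpha> v + t * \<beta> v) \<in> closed_simplex \<sigma>"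
  using assms by (auto simp: closed_simplex_def sum.distrib simp flip: sum_distrib_left)

text \<open>The straight-line homotopy works: both images of a point of
  \<open>closed_simplex \<sigma>\<close> lie in the simplex spanned by \<open>f\<close> \<sigma>
  \<union> g \<open>\<sigma>\<close>, which is convex. Since \<open>K\<close> and \<open>L\<close>
  are finite, both realizations are subspaces of products of lines, so joint continuity in time and
  point reduces to coordinates.\<close>

lemma homotopic_realization_map_contiguous:
  assumes K: "finite K" "simplicial_complex K" and L: "finite L" "simplicial_complex L"
    and contig: "\<And>\<sigma>. \<sigma> \<in> K \<Longrightarrow> f ` \<sigma> \<union> g ` \<sigma> \<in> L"
  shows "homotopic_with (\<lambda>x. True) (geometric_realization K) (geometric_realization L)
           (realization_map f) (realization_map g)"
  unfolding homotopic_with_def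
proof (intro exI conjI allI ballI)
  let ?K = "\<Union>\<sigma>\<in>K. closed_simplex \<sigma>" and ?L = "\<Union>\<sigma>\<in>L. closed_simplex \<sigma>"
  let ?h = "\<lambda>(t, \<alpha>) v. (1 - t) * realization_map f \<alpha> v + t * realization_map g \<alpha> v"
  have *: "continuous_on ({0..1::real} \<times> ?K) (\<lambda>x. realization_map k (snd x) v)" for k :: "'a \<Rightarrow> 'b" and v
  proof (rule continuous_on_compose2[OF _ continuous_on_snd[OF continuous_on_id]])
    show "continuous_on ?K (\<lambda>\<alpha>. realization_map k \<alpha> v)"
      by (rule continuous_on_product_then_coordinatewise[OF continuous_on_realization_map[OF K]])
  qed auto
  have "continuous_on ({0..1} \<times> ?K) ?h"
    unfolding case_prod_unfold
    by (intro continuous_on_coordinatewise_then_product continuous_intros *)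
  moreover have "?h (t, \<alpha>) \<in> ?L" if t: "t \<in> {0..1}" and \<alpha>: "\<alpha> \<in> closed_simplex \<sigma>" and \<sigma>: "\<sigma> \<in> K" for t \<alpha> \<sigma>
  proof -
    have fin: "finite \<sigma>" "finite (f ` \<sigma> \<union> g ` \<sigma>)"
      using K(2) \<sigma> by (auto simp: simplicial_complex_def)
    have "realization_map f \<alpha> \<in> closed_simplex (f ` \<sigma> \<union> g ` \<sigma>)"
      "realization_map g \<alpha> \<in> closed_simplex (f ` \<sigma> \<union> g ` \<sigma>)"
      using realization_map_closed_simplex[OF fin(1) \<alpha>] closed_simplex_mono[OF fin(2)] by blast+
    then have "?h (t, \<alpha>) \<in> closed_simplex (f ` \<sigma> \<union> g ` \<sigma>)"
      using closed_simplex_convex t by fastforce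
    then show ?thesis using contig[OF \<sigma>] by blast
  qed
  then have "?h ` ({0..1} \<times> ?K) \<subseteq> ?L" by fast
  ultimately show "continuous_map (prod_topology (top_of_set {0..1}) (geometric_realization K))
      (geometric_realization L) ?h"
    unfolding geometric_realization_finite[OF K(1)] geometric_realization_finite[OF L(1)]
      subtopology_Times[symmetric] prod_topology_euclidean
    by (intro continuous_map_into_subtopology) auto
qed auto

text \<open>Whether a subset of \<open>V\<close> is a simplex of \<open>K\<close> depends only on
  its image. Adding to a simplex further vertices of \<open>V\<close> from the fibres that it
  already meets therefore gives a simplex again. This makes a section of \<open>f\<close> simplicial
  and its composite with \<open>f\<close> contiguous to the identity.\<close>

lemma homotopy_equivalence_full_preimage:
  assumes V: "finite V" and L: "simplicial_complex L" "\<Union>L \<subseteq> f ` V"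
    and K: "\<And>\<sigma>. \<sigma> \<in> K \<longleftrightarrow> \<sigma> \<subseteq> V \<and> f ` \<sigma> \<in> L"
  shows "homotopy_equivalence (geometric_realization K) (geometric_realization L) (realization_map f)"
proof -
  define i where "i = inv_into V f"
  have fi: "f (i w) = w" "i w \<in> V" if "w \<in> f ` V" for w
    using that by (auto simp: i_def f_inv_into_f inv_into_into)
  have fi_image: "f ` i ` \<tau> = \<tau>" if "\<tau> \<subseteq> f ` V" for \<tau>
    using fi(1) that by (simp add: image_image subset_iff cong: image_cong)
  have "K \<subseteq> Pow V" "L \<subseteq> Pow (f ` V)" using K L(2) by auto
  then have finK: "finite K" and finL: "finite L"
    using V by (meson finite_Pow_iff finite_imageI finite_subset)+
  have scK: "simplicial_complex K"
    unfolding simplicial_complex_def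
  proof (intro ballI conjI allI impI)
    fix \<sigma> \<tau> assume "\<sigma> \<in> K"
    then show "finite \<sigma>" using V K finite_subset by blast
    assume "\<tau> \<subseteq> \<sigma>"
    then show "\<tau> \<in> K"
      using L(1) \<open>\<sigma> \<in> K\<close> image_mono[of \<tau> \<sigma> f] unfolding simplicial_complex_def K by blast
  qed
  have f: "simplicial_map K L f" using K by (simp add: simplicial_map_def)
  have i: "simplicial_map L K i"
    using L(2) fi fi_image unfolding simplicial_map_def K by (metis Sup_le_iff image_subset_iff subsetD)
  note contf = continuous_map_realization_map[OF finK scK finL f]
  note conti = continuous_map_realization_map[OF finL L(1) finK i]
  have "homotopic_with (\<lambda>x. True) (geometric_realization K) (geometric_realization K)
      (realization_map i \<circ> realization_map f) id"
  proof (rule homotopic_with_trans)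
    show "homotopic_with (\<lambda>x. True) (geometric_realization K) (geometric_realization K)
        (realization_map i \<circ> realization_map f) (realization_map (i \<circ> f))"
      using scK continuous_map_compose[OF contf conti]
      by (intro homotopic_with_equal)
        (auto simp: topspace_geometric_realization simplicial_complex_def realization_map_comp)
    \<comment> \<open>Contiguity: \<open>i\<close> f \<open>\<sigma>\<close> and
      \<open>\<sigma>\<close> have the same image under \<open>f\<close>, so their union has that
      image too.\<close>
    have "(i \<circ> f) ` \<sigma> \<union> id ` \<sigma> \<in> K" if "\<sigma> \<in> K" for \<sigma>
    proof -
      have "\<sigma> \<subseteq> V" "f ` \<sigma> \<in> L" using that K by auto
      then have "f ` i ` f ` \<sigma> = f ` \<sigma>" "i ` f ` \<sigma> \<subseteq> V" using fi_image fi by blast+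
      then show ?thesis using \<open>\<sigma> \<subseteq> V\<close> \<open>f ` \<sigma> \<in> L\<close>
        unfolding K by (simp only: image_Un image_comp[symmetric] image_id id_apply Un_absorb) simp
    qed
    then have "homotopic_with (\<lambda>x. True) (geometric_realization K) (geometric_realization K)
        (realization_map (i \<circ> f)) (realization_map id)"
      by (intro homotopic_realization_map_contiguous finK scK)
    moreover have "homotopic_with (\<lambda>x. True) (geometric_realization K) (geometric_realization K)
        (realization_map id) id"
    proof (rule homotopic_with_equal)
      show "continuous_map (geometric_realization K) (geometric_realization K) (realization_map id)"
        using finK scK by (intro continuous_map_realization_map) (auto simp: simplicial_map_def)
      fix \<alpha> assume "\<alpha> \<in> topspace (geometric_realization K)"
      then show "realization_map id \<alpha> = id \<alpha>"
        using scK realization_map_id_on[of _ \<alpha> id]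
        by (auto simp: topspace_geometric_realization simplicial_complex_def)
    qed auto
    ultimately show "homotopic_with (\<lambda>x. True) (geometric_realization K) (geometric_realization K)
        (realization_map (i \<circ> f)) id"
      by (rule homotopic_with_trans)
  qed
  moreover have "homotopic_with (\<lambda>x. True) (geometric_realization L) (geometric_realization L)
      (realization_map f \<circ> realization_map i) id"
  \<comment> \<open>On this side \<open>f \<circ> i\<close> fixes every vertex of \<open>L\<close>,
    so the composite equals the identity on the realization.\<close>
  proof (rule homotopic_with_equal)
    fix \<beta> assume "\<beta> \<in> topspace (geometric_realization L)"
    then obtain \<tau> where \<tau>: "\<tau> \<in> L" "\<beta> \<in> closed_simplex \<tau>"
      by (auto simp: topspace_geometric_realization)
    then have "finite \<tau>" "\<And>w. w \<in> \<tau> \<Longrightarrow> (f \<circ> i) w = w"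
      using L fi by (auto simp: simplicial_complex_def)
    then show "(realization_map f \<circ> realization_map i) \<beta> = id \<beta>"
      using \<tau>(2) realization_map_id_on[of \<tau> \<beta> "f \<circ> i"] by (simp add: realization_map_comp)
  qed (use continuous_map_compose[OF conti contf] in auto)
  ultimately show ?thesis
    using contf conti unfolding homotopy_equivalence_def by blast
qed

section \<open>Delaunay dissimilarities\<close>

lemma h_fun_0: "0 < \<epsilon> \<Longrightarrow> h_fun \<epsilon> 0 = 0"
  by (simp add: h_fun_def)

lemma h_fun_mono: "0 < \<epsilon> \<Longrightarrow> mono (h_fun \<epsilon>)"
proof
  fix a b :: ennreal assume \<epsilon>: "0 < \<epsilon>" and ab: "a \<le> b"
  show "h_fun \<epsilon> a \<le> h_fun \<epsilon> b"
  proof (cases "b < ennreal \<epsilon>")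
    case True
    then have "b < top" by (rule order_less_trans) simp
    then have "enn2real a \<le> enn2real b" using ab by (intro enn2real_mono)
    moreover have "enn2real b < \<epsilon>"
      using True \<epsilon> \<open>b < top\<close> by (cases b) (auto simp: ennreal_less_iff)
    ultimately show ?thesis using \<epsilon> ab True by (auto simp: h_fun_def intro!: ennreal_leI divide_right_mono)
  qed (simp add: h_fun_def)
qed

text \<open>Below \<epsilon> the function is locally the logarithmic formula, above \<epsilon> it is
  locally constant, and at \<epsilon> the logarithm tends to infinity.\<close>

lemma continuous_on_h_fun:
  assumes "0 < \<epsilon>"
  shows "continuous_on UNIV (\<lambda>r. h_fun \<epsilon> (ennreal r))"
proof -
  \<comment> \<open>The term \<open>max 0 r\<close> accounts for \<open>ennreal\<close> sending
    negative reals to 0, so that the formula is valid on the whole line.\<close>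
  have eq: "h_fun \<epsilon> (ennreal r) = (if r < \<epsilon> then ennreal (- ln (1 - max 0 r / \<epsilon>)) else \<infinity>)" for r
  proof (cases "0 \<le> r")
    case True
    then show ?thesis by (simp add: h_fun_def ennreal_less_iff)
  next
    case False
    then show ?thesis using assms by (simp add: h_fun_def ennreal_neg)
  qed
  have "isCont (\<lambda>r. h_fun \<epsilon> (ennreal r)) a" for a
  proof (cases a \<epsilon> rule: linorder_cases)
    case less
    have *: "isCont (\<lambda>r. ennreal (- ln (1 - max 0 r / \<epsilon>))) a"
      using less assms unfolding isCont_def
      by (intro tendsto_ennrealI tendsto_intros) auto
    have "\<forall>\<^sub>F r in nhds a. h_fun \<epsilon> (ennreal r) = ennreal (- ln (1 - max 0 r / \<epsilon>))"
      using eventually_nhds_in_open[of "{..<\<epsilon>}" a] less by (auto elim!: eventually_mono simp: eq)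
    then show ?thesis by (rule isCont_cong[THEN iffD2]) (rule *)
  next
    case greater
    have "\<forall>\<^sub>F r in nhds a. h_fun \<epsilon> (ennreal r) = \<infinity>"
      using eventually_nhds_in_open[of "{\<epsilon><..}" a] greater by (auto elim!: eventually_mono simp: eq)
    then show ?thesis by (rule isCont_cong[THEN iffD2]) simp
  next
    case equal
    \<comment> \<open>The open condition \<open>1 - r / \<epsilon> < exp (- M)\<close> holds at
      \<epsilon>, where the left side is 0. For \<open>r < \<epsilon>\<close>, taking logarithms
      gives a value above \<open>M\<close>; from \<epsilon> on the value is infinite.\<close>
    have "\<forall>\<^sub>F r in nhds \<epsilon>. ennreal M < h_fun \<epsilon> (ennreal r)" if "0 \<le> M" for M
    proof -
      have "\<forall>\<^sub>F r in nhds \<epsilon>. r \<in> {0<..} \<inter> {r. 1 - r / \<epsilon> < exp (- M)}"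
        using assms by (intro eventually_nhds_in_open open_Int open_Collect_less continuous_intros) auto
      then show ?thesis
      proof eventually_elim
        case (elim r)
        show ?case
        proof (cases "r < \<epsilon>")
          case True
          then have "ln (1 - r / \<epsilon>) < - M"
            using elim assms by (subst ln_less_cancel_iff[of _ "exp (- M)", simplified]) auto
          then show ?thesis using True elim that by (simp add: eq ennreal_less_iff)
        qed (simp add: eq)
      qed
    qed
    then have "((\<lambda>r. h_fun \<epsilon> (ennreal r)) \<longlongrightarrow> \<infinity>) (nhds \<epsilon>)"
      by (simp add: tendsto_top_iff_ennreal)
    then have "((\<lambda>r. h_fun \<epsilon> (ennreal r)) \<longlongrightarrow> \<infinity>) (at \<epsilon>)"
      by (rule tendsto_mono[rotated]) (simp add: at_within_def)
    then show ?thesis by (simp add: isCont_def equal eq)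
  qed
  then show ?thesis by (simp add: continuous_at_imp_continuous_on)
qed

section \<open>Continuity of the dissimilarities, and their sublevel sets\<close>

lemma continuous_on_Del_diss:
  assumes "0 < \<epsilon>"
  shows "continuous_on UNIV (\<lambda>q. Del_diss \<epsilon> (c, q))"
  using continuous_on_compose2[OF continuous_on_h_fun[OF assms] continuous_on_infdist[OF continuous_on_id]]
  by (simp add: Del_diss_def)

text \<open>With a discrete first factor, the preimage of an open set is the union of its slices
  \<open>{c} \<times> {q. \<Lambda> (c, q) \<in> U}\<close>, so continuity in the second variable
  suffices.\<close>

lemma dissimilarity_discrete:
  assumes "\<And>c. c \<in> V \<Longrightarrow> continuous_on UNIV (\<lambda>q. \<Lambda> (c, q))"
  shows "dissimilarity (discrete_topology V) euclidean \<Lambda>"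
  unfolding dissimilarity_def continuous_map_def
proof (intro conjI allI impI)
  let ?T = "prod_topology (discrete_topology V) euclidean"
  fix U :: "ennreal set" assume U: "openin euclidean U"
  have "open {q. \<Lambda> (c, q) \<in> U}" if "c \<in> V" for c
    using open_vimage[OF _ assms[OF that]] U by (simp add: vimage_def)
  then have "openin ?T (\<Union>c\<in>V. {c} \<times> {q. \<Lambda> (c, q) \<in> U})"
    by (intro openin_Union) (auto simp: openin_prod_Times_iff)
  moreover have "(\<Union>c\<in>V. {c} \<times> {q. \<Lambda> (c, q) \<in> U}) = {x \<in> topspace ?T. \<Lambda> x \<in> U}" by auto
  ultimately show "openin ?T {x \<in> topspace ?T. \<Lambda> x \<in> U}" by simp
qed simp

text \<open>The parameter \<pi> assigns to a cell its centre in the lower-dimensional space: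
  \<open>fst \<circ> fst\<close> yields \<open>D_diss\<close>, and \<open>fst\<close> yields
  \<open>DelCech_diss\<close>.\<close>

lemma dissimilarity_max_Del_diss:
  assumes "0 < \<epsilon>"
  shows "dissimilarity (discrete_topology V) euclidean
    (\<lambda>(c, p, q). max (ennreal (dist (\<pi> c) p)) (Del_diss \<epsilon> (c, q)))"
proof (rule dissimilarity_discrete)
  fix c
  have "continuous_on UNIV (\<lambda>y. ennreal (dist (\<pi> c) (fst y)))"
    by (intro continuous_on_ennreal continuous_intros)
  moreover have "continuous_on UNIV (\<lambda>y. Del_diss \<epsilon> (c, snd y))"
    using continuous_on_compose2[OF continuous_on_Del_diss[OF assms] continuous_on_snd[OF continuous_on_id]]
    by blast
  ultimately show "continuous_on UNIV
      (\<lambda>y. case (c, y) of (c, p, q) \<Rightarrow> max (ennreal (dist (\<pi> c) p)) (Del_diss \<epsilon> (c, q)))"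
    unfolding case_prod_unfold fst_conv snd_conv by (rule continuous_on_max)
qed

text \<open>A common point of the cells has value \<open>h_fun \<epsilon> 0 = 0\<close> at each of
  them. Conversely, values below \<open>ennreal t\<close> are finite, which forces all distances
  below \<epsilon> and contradicts \<open>2 * \<epsilon> < Del_eps \<sigma>\<close> for a
  non-Delaunay \<sigma>. The right side is thus the same condition for every positive
  \<open>t\<close>.\<close>

lemma Delaunay_iff_Del_diss:
  assumes adm: "admissible_eps C \<epsilon>" and "finite C" "\<sigma> \<subseteq> C" "0 < t"
  shows "\<sigma> \<in> Delaunay C \<longleftrightarrow> (\<exists>q. \<forall>c\<in>\<sigma>. Del_diss \<epsilon> (c, q) < ennreal t)"
proof
  have \<epsilon>: "0 < \<epsilon>" using adm by (simp add: admissible_eps_def)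
  show "\<exists>q. \<forall>c\<in>\<sigma>. Del_diss \<epsilon> (c, q) < ennreal t" if del: "\<sigma> \<in> Delaunay C"
  proof -
    obtain p where "\<forall>c\<in>\<sigma>. p \<in> snd c" using del by (auto simp: Delaunay_def)
    then have "\<forall>c\<in>\<sigma>. Del_diss \<epsilon> (c, p) < ennreal t"
      using \<epsilon> \<open>0 < t\<close> by (auto simp: Del_diss_def h_fun_0 ennreal_less_zero_iff)
    then show ?thesis by blast
  qed
  assume "\<exists>q. \<forall>c\<in>\<sigma>. Del_diss \<epsilon> (c, q) < ennreal t"
  then obtain q where q: "\<And>c. c \<in> \<sigma> \<Longrightarrow> Del_diss \<epsilon> (c, q) < ennreal t" by blast
  have near: "infdist q (snd c) < \<epsilon>" if "c \<in> \<sigma>" for c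
  proof (rule ccontr)
    assume "\<not> infdist q (snd c) < \<epsilon>"
    then have "Del_diss \<epsilon> (c, q) = \<infinity>"
      by (simp add: Del_diss_def h_fun_def ennreal_less_iff infdist_nonneg)
    then show False using q[OF that] by simp
  qed
  show "\<sigma> \<in> Delaunay C"
  proof (rule ccontr)
    assume not: "\<sigma> \<notin> Delaunay C"
    then have "\<sigma> \<noteq> {}" by (auto simp: Delaunay_def)
    have fin: "finite \<sigma>" using assms finite_subset by blast
    let ?m = "\<lambda>p. Max ((\<lambda>c. infdist p (snd c)) ` \<sigma>)"
    \<comment> \<open>This lower bound is needed for the real infimum
      \<open>Del_eps \<sigma>\<close> to lie below its value at \<open>q\<close>.\<close>
    have "0 \<le> ?m p" for p
      using fin \<open>\<sigma> \<noteq> {}\<close> by (auto simp: Max_ge_iff infdist_nonneg)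
    then have "Del_eps \<sigma> \<le> ?m q"
      unfolding Del_eps_def by (intro cINF_lower bdd_belowI2[where m = 0]) auto
    also have "\<dots> < \<epsilon>" using fin \<open>\<sigma> \<noteq> {}\<close> near by simp
    finally have "Del_eps \<sigma> < \<epsilon>" .
    moreover have "2 * \<epsilon> < Del_eps \<sigma>" using adm not \<open>\<sigma> \<subseteq> C\<close> by (auto simp: admissible_eps_def)
    ultimately show False using \<epsilon> by simp
  qed
qed

section \<open>Cells of the lifted point set\<close>

text \<open>Comparing only with centres in the same layer, the last coordinates contribute equally
  to both distances and cancel.\<close>

lemma fst_Vor_cell_Z_set:
  fixes X1 X2 :: "'a::metric_space set"
  assumes "(p, r) \<in> Vor_cell (Z_set X1 X2 s) (x, a)" and "(x, a) \<in> Z_set X1 X2 s"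
  shows "p \<in> Vor_cell (if a = s then X1 else X2) x"
proof -
  have "dist x p \<le> dist x' p" if "x' \<in> (if a = s then X1 else X2)" for x'
  proof -
    have "(x', a) \<in> Z_set X1 X2 s" using that assms(2) by (auto simp: Z_set_def split: if_splits)
    then have "dist (x, a) (p, r) \<le> dist (x', a) (p, r)" using assms(1) by (simp add: Vor_cell_def)
    then show ?thesis by (simp add: dist_Pair_Pair)
  qed
  then show ?thesis by (simp add: Vor_cell_def)
qed

lemma Vor_cell_infdist:
  assumes "p \<in> Vor_cell W w" "w \<in> W"
  shows "infdist p W = dist w p"
proof (rule antisym)
  show "infdist p W \<le> dist w p" using assms(2) infdist_le[of w W p] by (simp add: dist_commute)
  have "dist w p \<le> (INF a\<in>W. dist p a)"
    using assms by (intro cINF_greatest) (auto simp: Vor_cell_def dist_commute)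
  then show "dist w p \<le> infdist p W" using assms(2) by (subst infdist_notempty) auto
qed

text \<open>The height \<open>r\<close> solves \<open>(infdist p X1)\<^sup>2 + (s - r)\<^sup>2 =
  (infdist p X2)\<^sup>2 + (s + r)\<^sup>2\<close>. The common value bounds the squared distance
  from \<open>(p, r)\<close> to every point of \<open>Z_set X1 X2 s\<close> from below and is
  attained at \<open>(x, a)\<close>. The height depends on \<open>p\<close> alone, so one lifted
  point serves all cells at once.\<close>

lemma Vor_cell_Z_set_lift:
  fixes X1 X2 :: "'a::metric_space set"
  assumes s: "0 < s" and xa: "(x, a) \<in> Z_set X1 X2 s"
    and p: "p \<in> Vor_cell (if a = s then X1 else X2) x"
  shows "(p, ((infdist p X1)\<^sup>2 - (infdist p X2)\<^sup>2) / (4 * s)) \<in> Vor_cell (Z_set X1 X2 s) (x, a)"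
proof -
  \<comment> \<open>If one of the sets is empty, its \<open>infdist\<close> is 0 by default. The
    argument still holds, as distances are then compared only within the other layer.\<close>
  define r where "r = ((infdist p X1)\<^sup>2 - (infdist p X2)\<^sup>2) / (4 * s)"
  define M where "M = (infdist p X1)\<^sup>2 + (s - r)\<^sup>2"
  have M2: "M = (infdist p X2)\<^sup>2 + (- s - r)\<^sup>2"
    using s by (simp add: M_def r_def power2_eq_square field_simps)
  have ge: "M \<le> (dist y p)\<^sup>2 + (b - r)\<^sup>2" if "(y, b) \<in> Z_set X1 X2 s" for y b
  proof -
    have *: "(infdist p W)\<^sup>2 \<le> (dist y p)\<^sup>2" if "y \<in> W" for W
      using infdist_le[OF that, of p] by (simp add: dist_commute infdist_nonneg power_mono)
    have "y \<in> X1 \<and> b = s \<or> y \<in> X2 \<and> b = - s" using that by (auto simp: Z_set_def)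
    then show ?thesis
    proof (elim disjE conjE)
      show ?thesis if "y \<in> X1" "b = s" using that * by (simp add: M_def)
      show ?thesis if "y \<in> X2" "b = - s" using that * by (simp add: M2)
    qed
  qed
  have eq: "(dist x p)\<^sup>2 + (a - r)\<^sup>2 = M"
  proof (cases "a = s")
    case True
    then have "infdist p X1 = dist x p" using xa p s by (intro Vor_cell_infdist) (auto simp: Z_set_def)
    then show ?thesis using True by (simp add: M_def)
  next
    case False
    then have "infdist p X2 = dist x p" "a = - s"
      using xa p by (auto simp: Z_set_def intro!: Vor_cell_infdist)
    then show ?thesis by (simp add: M2)
  qed
  have "dist (x, a) (p, r) \<le> dist (y, b) (p, r)" if "(y, b) \<in> Z_set X1 X2 s" for y b
    using ge[OF that] eq by (simp add: dist_Pair_Pair dist_real_def)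
  then show ?thesis unfolding r_def[symmetric] by (auto simp: Vor_cell_def)
qed

text \<open>Surjectivity provides the section of \<open>g_map\<close>. Injectivity can fail: a point
  of both sets whose two cells coincide has two preimages.\<close>

lemma g_map_image_Vor:
  fixes X1 X2 :: "'a::metric_space set"
  assumes "0 < s"
  shows "g_map X1 X2 s ` Vor (Z_set X1 X2 s) = Vor2 X1 X2"
proof -
  have "- s \<noteq> s" using assms by simp
  moreover have layer: "X \<times> {a} = (\<lambda>x. (x, a)) ` X" for X :: "'a set" and a :: real by auto
  ultimately show ?thesis
    by (simp add: g_map_def Vor_def Vor2_def Z_set_def layer image_Un image_image)
qed

lemma Delaunay_Z_set_iff:
  assumes s: "0 < s" and \<sigma>: "\<sigma> \<subseteq> Vor (Z_set X1 X2 s)"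
  shows "\<sigma> \<in> Delaunay (Vor (Z_set X1 X2 s)) \<longleftrightarrow> g_map X1 X2 s ` \<sigma> \<in> Delaunay (Vor2 X1 X2)"
proof -
  have fst_cell: "fst q \<in> snd (g_map X1 X2 s c)" if "c \<in> \<sigma>" "q \<in> snd c" for c q
    using that \<sigma> fst_Vor_cell_Z_set[of "fst q" "snd q"] by (auto simp: Vor_def g_map_def)
  have lift: "(p, ((infdist p X1)\<^sup>2 - (infdist p X2)\<^sup>2) / (4 * s)) \<in> snd c"
    if c: "c \<in> \<sigma>" "p \<in> snd (g_map X1 X2 s c)" for c p
  proof -
    obtain x a where "(x, a) \<in> Z_set X1 X2 s" "c = ((x, a), Vor_cell (Z_set X1 X2 s) (x, a))"
      using c(1) \<sigma> by (auto simp: Vor_def)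
    then show ?thesis
      using c(2) Vor_cell_Z_set_lift[OF s] by (simp add: g_map_def)
  qed
  have "g_map X1 X2 s ` \<sigma> \<subseteq> Vor2 X1 X2" using \<sigma> g_map_image_Vor[OF s] by blast
  then show ?thesis
    using \<sigma> fst_cell lift by (simp add: Delaunay_def) meson
qed

text \<open>The projection \<open>fst\<close> does not increase distances and carries each cell into
  the cell of its image under \<open>g_map\<close>; \<open>h_fun\<close> is monotone.\<close>

lemma Del_diss_g_map_le:
  assumes "0 < \<epsilon>" "c \<in> Vor (Z_set X1 X2 s)"
  shows "Del_diss \<epsilon> (g_map X1 X2 s c, fst q) \<le> Del_diss \<epsilon> (c, q)"
proof -
  obtain x a where xa: "(x, a) \<in> Z_set X1 X2 s" "c = ((x, a), Vor_cell (Z_set X1 X2 s) (x, a))"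
    using assms(2) by (auto simp: Vor_def)
  let ?V = "Vor_cell (Z_set X1 X2 s) (x, a)" and ?W = "Vor_cell (if a = s then X1 else X2) x"
  have "infdist (fst q) ?W \<le> dist q v" if "v \<in> ?V" for v
    using that xa fst_Vor_cell_Z_set[of "fst v" "snd v" X1 X2 s x a]
    by (intro infdist_le2[OF _ dist_fst_le]) auto
  \<comment> \<open>Nonemptiness of the cell makes \<open>infdist\<close> a true infimum instead of
    its default value 0.\<close>
  moreover have "(x, a) \<in> ?V" by (simp add: Vor_cell_def)
  ultimately have "infdist (fst q) ?W \<le> infdist q ?V"
    by (subst infdist_notempty) (auto intro!: cINF_greatest)
  then show ?thesis
    using monoD[OF h_fun_mono[OF assms(1)]] by (simp add: Del_diss_def xa g_map_def ennreal_leI)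
qed

text \<open>The two terms of the maximum involve separate coordinates of the witness
  \<open>(p, q)\<close>, so the existence of \<open>p\<close> and that of \<open>q\<close> are
  independent conditions.\<close>

lemma dowker_nerve_max_Del_diss_iff:
  assumes adm: "admissible_eps C \<epsilon>" and fin: "finite C" and t: "0 < t"
  shows "\<sigma> \<in> dowker_nerve (discrete_topology C) euclidean
      (\<lambda>(c, p, q). max (ennreal (dist (\<pi> c) p)) (Del_diss \<epsilon> (c, q))) t \<longleftrightarrow>
    \<sigma> \<in> Delaunay C \<and> (\<exists>p. \<forall>c\<in>\<sigma>. dist (\<pi> c) p < t)" (is "?l \<longleftrightarrow> ?r")
proof -
  have "?l \<longleftrightarrow> \<sigma> \<subseteq> C \<and> (\<exists>p. \<forall>c\<in>\<sigma>. dist (\<pi> c) p < t) \<and> (\<exists>q. \<forall>c\<in>\<sigma>. Del_diss \<epsilon> (c, q) < ennreal t)"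
    using finite_subset[OF _ fin, of \<sigma>] t
    by (simp add: dowker_nerve_def ennreal_less_iff) blast
  moreover have "\<sigma> \<in> Delaunay C \<Longrightarrow> \<sigma> \<subseteq> C" by (simp add: Delaunay_def)
  ultimately show ?thesis
    using Delaunay_iff_Del_diss[OF adm fin _ t, of \<sigma>] by blast
qed

section \<open>The morphism and the homotopy equivalence\<close>

lemma D_diss_eq:
  "D_diss \<epsilon> = (\<lambda>(c, p, q). max (ennreal (dist (fst (fst c)) p)) (Del_diss \<epsilon> (c, q)))"
  by (auto simp: D_diss_def)

lemma DelCech_diss_eq:
  "DelCech_diss \<epsilon> = (\<lambda>(c, p, q). max (ennreal (dist (fst c) p)) (Del_diss \<epsilon> (c, q)))"
  by (auto simp: DelCech_diss_def)

theorem proposition6p2: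
  fixes X1 X2 :: "(real ^ 'd) set" and \<epsilon> \<epsilon>1 \<epsilon>2 s s1 s2 :: real
  assumes "finite X1" and "finite X2"
    and "admissible_eps (Vor X1) \<epsilon>1" and "admissible_eps (Vor X2) \<epsilon>2"
    and "0 < s1"
    and "\<forall>t>0. \<forall>\<sigma>\<in>alpha_complex X1 \<epsilon>1 t. filtration_value (alpha_complex X1 \<epsilon>1) \<sigma> < s1"
    and "0 < s2"
    and "\<forall>t>0. \<forall>\<sigma>\<in>alpha_complex X2 \<epsilon>2 t. filtration_value (alpha_complex X2 \<epsilon>2) \<sigma> < s2"
    and "max s1 s2 < s"
    and "admissible_eps (Vor2 X1 X2) \<epsilon>" and "admissible_eps (Vor (Z_set X1 X2 s)) \<epsilon>"
  shows "dissimilarity_morphism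
           (discrete_topology (Vor (Z_set X1 X2 s))) euclidean (D_diss \<epsilon>)
           (discrete_topology (Vor2 X1 X2)) euclidean (DelCech_diss \<epsilon>)
           (g_map X1 X2 s) (map_prod id fst)
       \<and> (\<forall>t>0.
           let ND = dowker_nerve (discrete_topology (Vor (Z_set X1 X2 s))) euclidean (D_diss \<epsilon>) t;
               NDelCech = dowker_nerve (discrete_topology (Vor2 X1 X2)) euclidean (DelCech_diss \<epsilon>) t
           in simplicial_map ND NDelCech (g_map X1 X2 s) \<and>
              homotopy_equivalence (geometric_realization ND) (geometric_realization NDelCech)
                (realization_map (g_map X1 X2 s)))"
proof -
  note finX = assms(1,2) and adm2 = assms(10) and admZ = assms(11)
  have s: "0 < s" using assms(5,9) by simp
  have \<epsilon>: "0 < \<epsilon>" using adm2 by (simp add: admissible_eps_def)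
  let ?g = "g_map X1 X2 s" and ?VZ = "Vor (Z_set X1 X2 s)" and ?V2 = "Vor2 X1 X2"
  \<comment> \<open>The map preserves the projected centre. Hence the distance terms of the two
    dissimilarities agree, and the ball condition is the same for \<sigma> and its image.\<close>
  have fst_g: "fst (?g c) = fst (fst c)" for c by (simp add: g_map_def case_prod_unfold)
  have morphism: "dissimilarity_morphism (discrete_topology ?VZ) euclidean (D_diss \<epsilon>)
      (discrete_topology ?V2) euclidean (DelCech_diss \<epsilon>) ?g (map_prod id fst)"
    unfolding dissimilarity_morphism_def
  proof (intro conjI ballI)
    show "dissimilarity (discrete_topology ?VZ) euclidean (D_diss \<epsilon>)"
      unfolding D_diss_eq by (rule dissimilarity_max_Del_diss[OF \<epsilon>])
    show "dissimilarity (discrete_topology ?V2) euclidean (DelCech_diss \<epsilon>)"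
      unfolding DelCech_diss_eq by (rule dissimilarity_max_Del_diss[OF \<epsilon>])
    show "continuous_map (discrete_topology ?VZ) (discrete_topology ?V2) ?g"
      using g_map_image_Vor[OF s, of X1 X2] by auto
    show "continuous_map euclidean euclidean (map_prod id fst :: (real^'d) \<times> (real^'d) \<times> real \<Rightarrow> _)"
      by (auto simp: map_prod_def case_prod_unfold intro!: continuous_intros)
    fix c and y :: "(real^'d) \<times> (real^'d) \<times> real"
    assume "c \<in> topspace (discrete_topology ?VZ)"
    then have "Del_diss \<epsilon> (?g c, fst (snd y)) \<le> Del_diss \<epsilon> (c, snd y)"
      by (intro Del_diss_g_map_le[OF \<epsilon>]) simp
    then show "DelCech_diss \<epsilon> (?g c, map_prod id fst y) \<le> D_diss \<epsilon> (c, y)"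
      using fst_g[of c]
      by (simp add: DelCech_diss_eq D_diss_eq case_prod_unfold max.coboundedI2)
  qed
  have equivalence: "simplicial_map (dowker_nerve (discrete_topology ?VZ) euclidean (D_diss \<epsilon>) t)
          (dowker_nerve (discrete_topology ?V2) euclidean (DelCech_diss \<epsilon>) t) ?g \<and>
      homotopy_equivalence
        (geometric_realization (dowker_nerve (discrete_topology ?VZ) euclidean (D_diss \<epsilon>) t))
        (geometric_realization (dowker_nerve (discrete_topology ?V2) euclidean (DelCech_diss \<epsilon>) t))
        (realization_map ?g)" (is "simplicial_map ?K ?L _ \<and> _") if t: "0 < t" for t
  proof -
    have fin: "finite ?VZ" "finite ?V2" using finX by (simp_all add: Vor_def Vor2_def Z_set_def)
    \<comment> \<open>The nerve of \<open>D_diss\<close> is the full preimage of the other nerve: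
      the ball conditions coincide, and \<open>Delaunay_Z_set_iff\<close> matches the Delaunay
      conditions.\<close>
    have K: "\<sigma> \<in> ?K \<longleftrightarrow> \<sigma> \<subseteq> ?VZ \<and> ?g ` \<sigma> \<in> ?L" for \<sigma>
    proof -
      have "\<sigma> \<in> ?K \<longleftrightarrow> \<sigma> \<in> Delaunay ?VZ \<and> (\<exists>p. \<forall>c\<in>\<sigma>. dist (fst (fst c)) p < t)"
        unfolding D_diss_eq by (rule dowker_nerve_max_Del_diss_iff[OF admZ fin(1) t])
      moreover have "?g ` \<sigma> \<in> ?L \<longleftrightarrow> ?g ` \<sigma> \<in> Delaunay ?V2 \<and> (\<exists>p. \<forall>c\<in>\<sigma>. dist (fst (fst c)) p < t)"
        unfolding DelCech_diss_eq dowker_nerve_max_Del_diss_iff[OF adm2 fin(2) t] by (simp add: fst_g)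
      moreover have "\<sigma> \<in> Delaunay ?VZ \<Longrightarrow> \<sigma> \<subseteq> ?VZ" by (simp add: Delaunay_def)
      ultimately show ?thesis using Delaunay_Z_set_iff[OF s, of \<sigma> X1 X2] by blast
    qed
    have "\<Union>?L \<subseteq> ?g ` ?VZ" unfolding g_map_image_Vor[OF s] by (auto simp: dowker_nerve_def)
    then have "homotopy_equivalence (geometric_realization ?K) (geometric_realization ?L) (realization_map ?g)"
      by (intro homotopy_equivalence_full_preimage[OF fin(1) simplicial_complex_dowker_nerve _ K])
    then show ?thesis using K by (simp add: simplicial_map_def)
  qed
  show ?thesis using morphism equivalence by (simp add: Let_def)
qed

end
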